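(* Assume $N\ge2$ and that conditions A, D' and E' hold for the semi-Markov processes $\eta^{(\varepsilon)}(t)$, $\varepsilon\in(0,\varepsilon_0]$, together with the paper's standing regularity conditions on the semi-Markov kernels, and let $\delta^*=\min_{i\in\mathbb{X},\,j\in\mathbb{Y}_i}(\delta_{ij}\wedge\dot\delta_{ij})$. Then for every $r\in\mathbb{X}$ the reduced semi-Markov processes ${}_r\eta^{(\varepsilon)}(t)$ satisfy conditions A and D' (with transition probabilities ${}_rp_{ij}$ and sets ${}_r\mathbb{Y}_i$, same $\varepsilon_0$) and the same standing regularity conditions, and they satisfy condition E': for every $i\in{}_r\mathbb{X}$, $j\in{}_r\mathbb{Y}_i$ there are integers ${}_rm^-_{ij}\le{}_rm^+_{ij}$, reals ${}_rb_{ij}[l]$ with ${}_rb_{ij}[{}_rm^-_{ij}]>0$, and ${}_r\dot\delta_{ij}\in(0,1]$, ${}_r\dot G_{ij}\in(0,\infty)$, ${}_r\dot\varepsilon_{ij}\in(0,\varepsilon_0]$ such that $\big|{}_re_{ij}(\varepsilon)-\sum_{l={}_rm^-_{ij}}^{{}_rm^+_{ij}}{}_rb_{ij}[l]\varepsilon^l\big|\le{}_r\dot G_{ij}\varepsilon^{{}_rm^+_{ij}+{}_r\dot\delta_{ij}}$ for $0<\varepsilon\le{}_r\dot\varepsilon_{ij}$. Moreover this holds with ${}_r\dot\delta_{ij}\ge\delta^*$ for all $j\in{}_r\mathbb{Y}_i$, $i\in{}_r\mathbb{X}$, $r\in\mathbb{X}$.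
   Context: Let $\mathbb{X}=\{1,\dots,N\}$, $0<\varepsilon_0\le1$. For each $\varepsilon\in(0,\varepsilon_0]$, $\eta^{(\varepsilon)}(t)$ is a semi-Markov process on $\mathbb{X}$ with semi-Markov transition probabilities $Q^{(\varepsilon)}_{ij}(t)$; $p_{ij}(\varepsilon)=Q^{(\varepsilon)}_{ij}(\infty)$ are the transition probabilities of the embedded Markov chain and $e_{ij}(\varepsilon)=\int_0^\infty t\,Q^{(\varepsilon)}_{ij}(dt)$ the (finite) expectations of sojourn times. The paper also assumes standing regularity conditions on $Q^{(\varepsilon)}_{ij}$ guaranteeing a well-defined process with finite $e_{ij}(\varepsilon)$; the claim concerns only $p_{ij}$ and $e_{ij}$. Condition A: there are nonempty $\mathbb{Y}_i\subseteq\mathbb{X}$ with (a) $p_{ij}(\varepsilon)>0$ for $j\in\mathbb{Y}_i$; (b) $p_{ij}(\varepsilon)=0$ (hence $e_{ij}(\varepsilon)=0$) for $j\notin\mathbb{Y}_i$; (c) for all $i,j$ there are $n\ge1$ and $i=l_0,\dots,l_n=j$ with $l_m\in\mathbb{Y}_{l_{m-1}}$. Condition D': for $j\in\mathbb{Y}_i$, $p_{ij}(\varepsilon)=\sum_{l=l^-_{ij}}^{l^+_{ij}}a_{ij}[l]\varepsilon^l+o_{ij}(\varepsilon)$ with integers $0\le l^-_{ij}\le l^+_{ij}$, $a_{ij}[l^-_{ij}]>0$, $|o_{ij}(\varepsilon)|\le G_{ij}\varepsilon^{l^+_{ij}+\delta_{ij}}$ for $0<\varepsilon\le\varepsilon_{ij}$,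 $\delta_{ij}\in(0,1]$, $G_{ij}\in(0,\infty)$, $\varepsilon_{ij}\in(0,\varepsilon_0]$. Condition E': for $j\in\mathbb{Y}_i$, $e_{ij}(\varepsilon)=\sum_{l=m^-_{ij}}^{m^+_{ij}}b_{ij}[l]\varepsilon^l+\dot o_{ij}(\varepsilon)$ with integers $m^-_{ij}\le m^+_{ij}$, $b_{ij}[m^-_{ij}]>0$, $|\dot o_{ij}(\varepsilon)|\le\dot G_{ij}\varepsilon^{m^+_{ij}+\dot\delta_{ij}}$ for $0<\varepsilon\le\dot\varepsilon_{ij}$, $\dot\delta_{ij}\in(0,1]$, $\dot G_{ij}\in(0,\infty)$, $\dot\varepsilon_{ij}\in(0,\varepsilon_0]$. Reduced process: for $r\in\mathbb{X}$, ${}_r\eta^{(\varepsilon)}(t)$ is the semi-Markov process on ${}_r\mathbb{X}=\mathbb{X}\setminus\{r\}$ obtained by observing $\eta^{(\varepsilon)}$ only at jump times into ${}_r\mathbb{X}$ (excursions through $r$ are absorbed into sojourn times); its embedded transition probabilities are ${}_rp_{ij}=p_{ij}+p_{ir}\frac{p_{rj}}{1-p_{rr}}$ and its sojourn expectations are ${}_re_{ij}=e_{ij}+e_{ir}\frac{p_{rj}}{1-p_{rr}}+e_{rr}\frac{p_{ir}}{1-p_{rr}}\frac{p_{rj}}{1-p_{rr}}+e_{rj}\frac{p_{ir}}{1-p_{rr}}$ (all functions of $\varepsilon$), $i,j\in{}_r\mathbb{X}$; its transition sets are ${}_r\mathbb{Y}_i=\{j\in{}_r\mathbb{X}: j\in\mathbb{Y}_i\text{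 or }(r\in\mathbb{Y}_i\text{ and }j\in\mathbb{Y}_r)\}$. *)

theory Defs
  imports Complex_Main
begin

text \<open>Transition probabilities and expectations are modelled as functions
  of (epsilon, i, j).\<close>

type_synonym kern = "real \<Rightarrow> nat \<Rightarrow> nat \<Rightarrow> real"

definition condA :: "nat set \<Rightarrow> real \<Rightarrow> kern \<Rightarrow> (nat \<Rightarrow> nat set) \<Rightarrow> bool" where
  "condA S eps0 p Y \<longleftrightarrow>
     (\<forall>i\<in>S. Y i \<noteq> {} \<and> Y i \<subseteq> S) \<and>
     (\<forall>eps. 0 < eps \<and> eps \<le> eps0 \<longrightarrow>
        (\<forall>i\<in>S. \<forall>j\<in>S. (j \<in> Y i \<longrightarrow> p eps i j > 0) \<and> (j \<notin> Y i \<longrightarrow> p eps i j = 0))) \<and>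
     (\<forall>i\<in>S. \<forall>j\<in>S. \<exists>n::nat. n \<ge> 1 \<and> (\<exists>l::nat \<Rightarrow> nat.
        l 0 = i \<and> l n = j \<and> (\<forall>m\<in>{1..n}. l m \<in> Y (l (m - 1)))))"

text \<open>Standing regularity conditions, as far as they concern p and e:
  p(eps) is a stochastic matrix on S, e is nonnegative and vanishes where p vanishes.\<close>
definition smp_regular :: "nat set \<Rightarrow> real \<Rightarrow> kern \<Rightarrow> kern \<Rightarrow> bool" where
  "smp_regular S eps0 p e \<longleftrightarrow>
     (\<forall>eps. 0 < eps \<and> eps \<le> eps0 \<longrightarrow>
        (\<forall>i\<in>S. (\<forall>j\<in>S. 0 \<le> p eps i j \<and> 0 \<le> e eps i j \<and> (p eps i j = 0 \<longrightarrow> e eps i j = 0))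
              \<and> (\<Sum>j\<in>S. p eps i j) = 1))"

definition has_expansion ::
  "real \<Rightarrow> (real \<Rightarrow> real) \<Rightarrow> int \<Rightarrow> int \<Rightarrow> (int \<Rightarrow> real) \<Rightarrow> real \<Rightarrow> real \<Rightarrow> real \<Rightarrow> bool" where
  "has_expansion eps0 f lm lp a delta G eps1 \<longleftrightarrow>
     lm \<le> lp \<and> a lm > 0 \<and> 0 < delta \<and> delta \<le> 1 \<and> 0 < G \<and> 0 < eps1 \<and> eps1 \<le> eps0 \<and>
     (\<forall>eps. 0 < eps \<and> eps \<le> eps1 \<longrightarrow>
        \<bar>f eps - (\<Sum>l\<in>{lm..lp}. a l * eps powi l)\<bar> \<le> G * eps powr (real_of_int lp + delta))"

definition condD' :: "nat set \<Rightarrow> real \<Rightarrow> kern \<Rightarrow> (nat \<Rightarrow> nat set) \<Rightarrow> bool" where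
  "condD' S eps0 p Y \<longleftrightarrow> (\<forall>i\<in>S. \<forall>j\<in>Y i. \<exists>lm lp a delta G eps1.
      0 \<le> lm \<and> has_expansion eps0 (\<lambda>eps. p eps i j) lm lp a delta G eps1)"

definition red_p :: "kern \<Rightarrow> nat \<Rightarrow> kern" where
  "red_p p r eps i j = p eps i j + p eps i r * (p eps r j / (1 - p eps r r))"

definition red_e :: "kern \<Rightarrow> kern \<Rightarrow> nat \<Rightarrow> kern" where
  "red_e p e r eps i j =
     e eps i j + e eps i r * (p eps r j / (1 - p eps r r))
     + e eps r r * (p eps i r / (1 - p eps r r)) * (p eps r j / (1 - p eps r r))
     + e eps r j * (p eps i r / (1 - p eps r r))"

definition red_Y :: "nat set \<Rightarrow> (nat \<Rightarrow> nat set) \<Rightarrow> nat \<Rightarrow> nat \<Rightarrow> nat set" where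
  "red_Y S Y r i = {j \<in> S - {r}. j \<in> Y i \<or> (r \<in> Y i \<and> j \<in> Y r)}"

end

theory Submission
  imports Defs
begin

text \<open>Call \<open>f\<close> asymptotic of order \<open>m\<close> if \<open>f(\<epsilon>) = c \<epsilon>\<^sup>m + O(\<epsilon>\<^sup>m\<^sup>+\<^sup>\<delta>)\<close> for some \<open>c > 0\<close>.
  For \<open>\<epsilon> \<le> 1\<close> and a fixed \<open>\<delta> \<in> (0,1]\<close> this class is closed under sums, products and
  quotients, and an expansion as in D' or E' with remainder exponent at least \<open>\<delta>\<^sup>*\<close> puts a
  function into the class for \<open>\<delta> = \<delta>\<^sup>*\<close>. The escape probability \<open>1 - p\<^sub>r\<^sub>r\<close>, the sum of the
  \<open>p\<^sub>r\<^sub>j\<close> with \<open>j \<in> Y\<^sub>r - {r}\<close>, belongs to it because irreducibility makes that index set nonempty.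
  The reduced quantities \<open>\<^sub>rp\<^sub>i\<^sub>j\<close>, \<open>\<^sub>re\<^sub>i\<^sub>j\<close> are sums of products and quotients of class
  members in which every summand lies in the class or vanishes identically, and for
  \<open>j \<in> \<^sub>rY\<^sub>i\<close> the direct step \<open>i \<rightarrow> j\<close> or the detour \<open>i \<rightarrow> r \<rightarrow> j\<close> supplies a
  non-vanishing one. So they lie in the class for \<open>\<delta> = \<delta>\<^sup>*\<close>, which is a one-term expansion
  with remainder exponent \<open>\<delta>\<^sup>*\<close>.\<close>

definition leading_term :: "real \<Rightarrow> real \<Rightarrow> (real \<Rightarrow> real) \<Rightarrow> int \<Rightarrow> real \<Rightarrow> bool" where
  "leading_term e0 d f m c \<longleftrightarrow> 0 < c \<and> (\<exists>G e1. 0 < G \<and> 0 < e1 \<and> e1 \<le> e0 \<and>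
     (\<forall>x. 0 < x \<and> x \<le> e1 \<longrightarrow> \<bar>f x - c * x powr m\<bar> \<le> G * x powr (m + d)))"

lemma leading_termI:
  "0 < c \<Longrightarrow> 0 < G \<Longrightarrow> 0 < e1 \<Longrightarrow> e1 \<le> e0 \<Longrightarrow>
    (\<And>x. 0 < x \<Longrightarrow> x \<le> e1 \<Longrightarrow> \<bar>f x - c * x powr m\<bar> \<le> G * x powr (m + d)) \<Longrightarrow>
    leading_term e0 d f m c"
  unfolding leading_term_def by blast

lemma leading_termE:
  assumes "leading_term e0 d f m c"
  obtains G e1 where "0 < c" "0 < G" "0 < e1" "e1 \<le> e0"
    "\<And>x. 0 < x \<Longrightarrow> x \<le> e1 \<Longrightarrow> \<bar>f x - c * x powr m\<bar> \<le> G * x powr (m + d)"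
  using assms unfolding leading_term_def by blast

lemma leading_term_cong:
  assumes "leading_term e0 d f m c" "\<And>x. 0 < x \<Longrightarrow> x \<le> e0 \<Longrightarrow> f x = g x"
  shows "leading_term e0 d g m c"
proof -
  obtain G e1 where f: "0 < c" "0 < G" "0 < e1" "e1 \<le> e0"
    "\<And>x. 0 < x \<Longrightarrow> x \<le> e1 \<Longrightarrow> \<bar>f x - c * x powr m\<bar> \<le> G * x powr (m + d)"
    using leading_termE[OF assms(1)] by blast
  show ?thesis
    by (rule leading_termI[OF f(1-4)]) (use f(4,5) assms(2) in force)
qed

lemma leading_term_add_same_order:
  assumes "leading_term e0 d f m c1" "leading_term e0 d g m c2"
  shows "leading_term e0 d (\<lambda>x. f x + g x) m (c1 + c2)"
proof -
  obtain G1 e1 where f: "0 < c1" "0 < G1" "0 < e1" "e1 \<le> e0"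
    "\<And>x. 0 < x \<Longrightarrow> x \<le> e1 \<Longrightarrow> \<bar>f x - c1 * x powr m\<bar> \<le> G1 * x powr (m + d)"
    using leading_termE[OF assms(1)] by blast
  obtain G2 e2 where g: "0 < c2" "0 < G2" "0 < e2" "e2 \<le> e0"
    "\<And>x. 0 < x \<Longrightarrow> x \<le> e2 \<Longrightarrow> \<bar>g x - c2 * x powr m\<bar> \<le> G2 * x powr (m + d)"
    using leading_termE[OF assms(2)] by blast
  show ?thesis
  proof (rule leading_termI[of _ "G1 + G2" "min e1 e2"])
    fix x assume x: "0 < x" "x \<le> min e1 e2"
    have "f x + g x - (c1 + c2) * x powr m = (f x - c1 * x powr m) + (g x - c2 * x powr m)"
      by (simp add: algebra_simps)
    also have "\<bar>\<dots>\<bar> \<le> \<bar>f x - c1 * x powr m\<bar> + \<bar>g x - c2 * x powr m\<bar>"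
      by (rule abs_triangle_ineq)
    also have "\<dots> \<le> (G1 + G2) * x powr (m + d)"
      using f(5)[of x] g(5)[of x] x by (simp add: distrib_right)
    finally show "\<bar>f x + g x - (c1 + c2) * x powr m\<bar> \<le> (G1 + G2) * x powr (m + d)" .
  qed (use f(1-4) g(1-4) in auto)
qed

lemma abs_mult_approx_le:
  fixes f g A B D c1 c2 G1 G2 :: real
  assumes f: "\<bar>f - c1 * A\<bar> \<le> G1 * (A * D)" and g: "\<bar>g - c2 * B\<bar> \<le> G2 * (B * D)"
    and pos: "0 \<le> A" "0 \<le> B" "0 \<le> D" "D \<le> 1" "0 < c1" "0 < c2" "0 < G1" "0 < G2"
  shows "\<bar>f * g - c1 * c2 * (A * B)\<bar> \<le> (G1 * (c2 + G2) + c1 * G2) * (A * B * D)"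
proof -
  have "G2 * (B * D) \<le> G2 * B" "0 \<le> c2 * B" using pos by (simp_all add: mult_left_le)
  then have g_bound: "\<bar>g\<bar> \<le> (c2 + G2) * B" using g unfolding distrib_right abs_le_iff by linarith
  have "f * g - c1 * c2 * (A * B) = (f - c1 * A) * g + c1 * A * (g - c2 * B)"
    by (simp add: algebra_simps)
  also have "\<bar>\<dots>\<bar> \<le> \<bar>f - c1 * A\<bar> * \<bar>g\<bar> + c1 * A * \<bar>g - c2 * B\<bar>"
    using pos by (metis abs_mult abs_of_nonneg abs_triangle_ineq mult_nonneg_nonneg order.strict_implies_order)
  also have "\<dots> \<le> (G1 * (A * D)) * ((c2 + G2) * B) + c1 * A * (G2 * (B * D))"
    using f g g_bound pos by (intro add_mono mult_mono mult_left_mono) auto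
  also have "\<dots> = (G1 * (c2 + G2) + c1 * G2) * (A * B * D)" by (simp add: algebra_simps)
  finally show ?thesis .
qed

lemma abs_divide_approx_le:
  fixes f g A B D c1 c2 G1 G2 :: real
  assumes f: "\<bar>f - c1 * A\<bar> \<le> G1 * (A * D)" and g: "\<bar>g - c2 * B\<bar> \<le> G2 * (B * D)"
    and pos: "0 < A" "0 < B" "0 \<le> D" "G2 * D \<le> c2 / 2" "0 < c1" "0 < c2" "0 < G1" "0 < G2"
  shows "\<bar>f / g - c1 / c2 * (A / B)\<bar> \<le> (2 * (c2 * G1 + c1 * G2) / c2\<^sup>2) * (A / B * D)"
proof -
  have "G2 * (B * D) \<le> c2 / 2 * B" using pos mult_right_mono[OF pos(4), of B] by (simp add: algebra_simps)
  then have g_lower: "c2 / 2 * B \<le> g" using g unfolding abs_le_iff by linarith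
  moreover have "0 < c2 / 2 * B" using pos by simp
  ultimately have g_pos: "0 < g" by linarith
  have denom: "c2 / 2 * B * c2 * B \<le> g * c2 * B" "0 < c2 / 2 * B * c2 * B"
    using g_lower pos by (simp_all add: mult_right_mono)
  define num where "num = c2 * B * (f - c1 * A) - c1 * A * (g - c2 * B)"
  have "\<bar>num\<bar> \<le> c2 * B * \<bar>f - c1 * A\<bar> + c1 * A * \<bar>g - c2 * B\<bar>"
    unfolding num_def using abs_triangle_ineq4[of "c2 * B * (f - c1 * A)" "c1 * A * (g - c2 * B)"] pos
    by (simp add: abs_mult)
  also have "\<dots> \<le> c2 * B * (G1 * (A * D)) + c1 * A * (G2 * (B * D))"
    using f g pos by (intro add_mono mult_left_mono) auto
  also have "\<dots> = (c2 * G1 + c1 * G2) * (A * B * D)" by (simp add: algebra_simps)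
  finally have num_bound: "\<bar>num\<bar> \<le> (c2 * G1 + c1 * G2) * (A * B * D)" .
  have "f / g - c1 / c2 * (A / B) = num / (g * c2 * B)"
    unfolding num_def using g_pos pos by (simp add: field_simps)
  also have "\<bar>\<dots>\<bar> = \<bar>num\<bar> / (g * c2 * B)"
    using denom by (simp add: abs_divide)
  also have "\<dots> \<le> \<bar>num\<bar> / (c2 / 2 * B * c2 * B)"
    using denom by (intro divide_left_mono) auto
  also have "\<dots> \<le> (c2 * G1 + c1 * G2) * (A * B * D) / (c2 / 2 * B * c2 * B)"
    by (rule divide_right_mono) (use num_bound denom in auto)
  also have "\<dots> = (2 * (c2 * G1 + c1 * G2) / c2\<^sup>2) * (A / B * D)"
    using pos by (simp add: field_simps power2_eq_square)
  finally show ?thesis .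
qed

lemma powi_eq_powr: "0 < (x::real) \<Longrightarrow> x powi l = x powr (real_of_int l)"
  by (simp add: powr_real_of_int')

locale asymptotic_scale =
  fixes e0 d :: real
  assumes e0_le_1: "e0 \<le> 1" and d_pos: "0 < d" and d_le_1: "d \<le> 1"
begin

lemma leading_term_add_higher_order:
  assumes "leading_term e0 d f m1 c1" "leading_term e0 d g m2 c2" "m1 < m2"
  shows "leading_term e0 d (\<lambda>x. f x + g x) m1 c1"
proof -
  obtain G1 e1 where f: "0 < c1" "0 < G1" "0 < e1" "e1 \<le> e0"
    "\<And>x. 0 < x \<Longrightarrow> x \<le> e1 \<Longrightarrow> \<bar>f x - c1 * x powr m1\<bar> \<le> G1 * x powr (m1 + d)"
    using leading_termE[OF assms(1)] by blast
  obtain G2 e2 where g: "0 < c2" "0 < G2" "0 < e2" "e2 \<le> e0"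
    "\<And>x. 0 < x \<Longrightarrow> x \<le> e2 \<Longrightarrow> \<bar>g x - c2 * x powr m2\<bar> \<le> G2 * x powr (m2 + d)"
    using leading_termE[OF assms(2)] by blast
  show ?thesis
  proof (rule leading_termI[of _ "G1 + c2 + G2" "min e1 e2"])
    fix x assume x: "0 < x" "x \<le> min e1 e2"
    have x_le_1: "x \<le> 1" using x f(4) e0_le_1 by auto
    have order: "real_of_int m1 + d \<le> real_of_int m2" using assms(3) d_le_1 by linarith
    have "\<bar>g x\<bar> \<le> c2 * x powr m2 + \<bar>g x - c2 * x powr m2\<bar>"
      using abs_triangle_ineq2[of "g x" "c2 * x powr m2"] g(1) by (simp add: abs_mult)
    also have "\<dots> \<le> c2 * x powr m2 + G2 * x powr (m2 + d)"
      using g(5)[of x] x by simp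
    also have "\<dots> \<le> c2 * x powr (m1 + d) + G2 * x powr (m1 + d)"
      using g(1,2) x x_le_1 order d_pos
      by (intro add_mono mult_left_mono powr_mono') auto
    finally have g_small: "\<bar>g x\<bar> \<le> (c2 + G2) * x powr (m1 + d)" by (simp add: algebra_simps)
    have "f x + g x - c1 * x powr m1 = (f x - c1 * x powr m1) + g x" by simp
    also have "\<bar>\<dots>\<bar> \<le> \<bar>f x - c1 * x powr m1\<bar> + \<bar>g x\<bar>" by (rule abs_triangle_ineq)
    also have "\<dots> \<le> (G1 + c2 + G2) * x powr (m1 + d)"
      using f(5)[of x] g_small x by (simp add: algebra_simps)
    finally show "\<bar>f x + g x - c1 * x powr m1\<bar> \<le> (G1 + c2 + G2) * x powr (m1 + d)" .
  qed (use f(1-4) g(1-4) in auto)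
qed

lemma leading_term_add:
  assumes "leading_term e0 d f m1 c1" "leading_term e0 d g m2 c2"
  obtains c where "leading_term e0 d (\<lambda>x. f x + g x) (min m1 m2) c"
proof (cases m1 m2 rule: linorder_cases)
  case less
  then show ?thesis using leading_term_add_higher_order[OF assms] that by simp
next
  case equal
  then have "leading_term e0 d (\<lambda>x. f x + g x) m1 (c1 + c2)"
    using leading_term_add_same_order[OF assms(1)] assms(2) by simp
  then show ?thesis using equal that by simp
next
  case greater
  then have "leading_term e0 d (\<lambda>x. g x + f x) m2 c2"
    using leading_term_add_higher_order[OF assms(2,1)] by simp
  then show ?thesis using greater that by (simp add: add.commute)
qed

lemma leading_term_sum:
  assumes "finite A" "A \<noteq> {}" "\<forall>j\<in>A. leading_term e0 d (f j) (m j) (c j)"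
  obtains M C where "leading_term e0 d (\<lambda>x. \<Sum>j\<in>A. f j x) M C" "\<forall>j\<in>A. M \<le> m j"
proof -
  have "\<exists>M C. leading_term e0 d (\<lambda>x. \<Sum>j\<in>A. f j x) M C \<and> (\<forall>j\<in>A. M \<le> m j)"
    using assms
  proof (induction A rule: finite_ne_induct)
    case (singleton j)
    then show ?case by auto
  next
    case (insert j A)
    then obtain M C where "leading_term e0 d (\<lambda>x. \<Sum>j\<in>A. f j x) M C" "\<forall>j\<in>A. M \<le> m j"
      by auto
    moreover obtain C' where "leading_term e0 d (\<lambda>x. f j x + (\<Sum>j\<in>A. f j x)) (min (m j) M) C'"
      using leading_term_add insert.prems calculation(1) by blast
    ultimately show ?case using insert.hyps by (intro exI[of _ "min (m j) M"] exI[of _ C']) auto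
  qed
  then show ?thesis using that by blast
qed

lemma leading_term_mult:
  assumes "leading_term e0 d f m1 c1" "leading_term e0 d g m2 c2"
  shows "leading_term e0 d (\<lambda>x. f x * g x) (m1 + m2) (c1 * c2)"
proof -
  obtain G1 e1 where f: "0 < c1" "0 < G1" "0 < e1" "e1 \<le> e0"
    "\<And>x. 0 < x \<Longrightarrow> x \<le> e1 \<Longrightarrow> \<bar>f x - c1 * x powr m1\<bar> \<le> G1 * x powr (m1 + d)"
    using leading_termE[OF assms(1)] by blast
  obtain G2 e2 where g: "0 < c2" "0 < G2" "0 < e2" "e2 \<le> e0"
    "\<And>x. 0 < x \<Longrightarrow> x \<le> e2 \<Longrightarrow> \<bar>g x - c2 * x powr m2\<bar> \<le> G2 * x powr (m2 + d)"
    using leading_termE[OF assms(2)] by blast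
  show ?thesis
  proof (rule leading_termI[of _ "G1 * (c2 + G2) + c1 * G2" "min e1 e2"])
    fix x assume x: "0 < x" "x \<le> min e1 e2"
    have "x powr d \<le> 1" using x f(4) e0_le_1 d_pos by (intro powr_le1) auto
    then have "\<bar>f x * g x - c1 * c2 * (x powr m1 * x powr m2)\<bar>
        \<le> (G1 * (c2 + G2) + c1 * G2) * (x powr m1 * x powr m2 * x powr d)"
      using f g x by (intro abs_mult_approx_le) (auto simp: powr_add)
    then show "\<bar>f x * g x - c1 * c2 * x powr real_of_int (m1 + m2)\<bar>
        \<le> (G1 * (c2 + G2) + c1 * G2) * x powr (real_of_int (m1 + m2) + d)"
      by (simp add: powr_add)
  qed (use f(1-4) g(1-4) in \<open>auto intro!: add_pos_pos mult_pos_pos\<close>)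
qed

lemma leading_term_divide:
  assumes "leading_term e0 d f m1 c1" "leading_term e0 d g m2 c2"
  shows "leading_term e0 d (\<lambda>x. f x / g x) (m1 - m2) (c1 / c2)"
proof -
  obtain G1 e1 where f: "0 < c1" "0 < G1" "0 < e1" "e1 \<le> e0"
    "\<And>x. 0 < x \<Longrightarrow> x \<le> e1 \<Longrightarrow> \<bar>f x - c1 * x powr m1\<bar> \<le> G1 * x powr (m1 + d)"
    using leading_termE[OF assms(1)] by blast
  obtain G2 e2 where g: "0 < c2" "0 < G2" "0 < e2" "e2 \<le> e0"
    "\<And>x. 0 < x \<Longrightarrow> x \<le> e2 \<Longrightarrow> \<bar>g x - c2 * x powr m2\<bar> \<le> G2 * x powr (m2 + d)"
    using leading_termE[OF assms(2)] by blast
  \<comment> \<open>below \<open>e3\<close> the denominator stays above half its leading term\<close>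
  define e3 where "e3 = (c2 / (2 * G2)) powr (1 / d)"
  have e3: "0 < e3" unfolding e3_def using g(1,2) by simp
  show ?thesis
  proof (rule leading_termI[of _ "2 * (c2 * G1 + c1 * G2) / c2\<^sup>2" "min e1 (min e2 e3)"])
    fix x assume x: "0 < x" "x \<le> min e1 (min e2 e3)"
    have "x powr d \<le> e3 powr d" using x d_pos by (intro powr_mono2) auto
    also have "\<dots> = c2 / (2 * G2)" unfolding e3_def using g(1,2) d_pos by (simp add: powr_powr)
    finally have "G2 * x powr d \<le> c2 / 2" using g(1,2) by (simp add: field_simps)
    then have "\<bar>f x / g x - c1 / c2 * (x powr m1 / x powr m2)\<bar>
        \<le> (2 * (c2 * G1 + c1 * G2) / c2\<^sup>2) * (x powr m1 / x powr m2 * x powr d)"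
      using f g x by (intro abs_divide_approx_le) (auto simp: powr_add)
    then show "\<bar>f x / g x - c1 / c2 * x powr real_of_int (m1 - m2)\<bar>
        \<le> (2 * (c2 * G1 + c1 * G2) / c2\<^sup>2) * x powr (real_of_int (m1 - m2) + d)"
      by (simp add: powr_add powr_diff)
  qed (use f(1-4) g(1-4) e3 in \<open>auto intro!: divide_pos_pos add_pos_pos mult_pos_pos\<close>)
qed

text \<open>The terms of the expansion beyond the leading one are absorbed into the error, since
  \<open>\<epsilon>\<^sup>l \<le> \<epsilon>\<^sup>m\<^sup>+\<^sup>d\<close> for \<open>l > m\<close>, \<open>\<epsilon> \<le> 1\<close> and \<open>d \<le> 1\<close>.\<close>
lemma has_expansion_imp_leading_term:
  assumes h: "has_expansion e0 f m mp a \<delta> G e1" and "d \<le> \<delta>"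
  shows "leading_term e0 d f m (a m)"
proof -
  have h: "m \<le> mp" "0 < a m" "0 < \<delta>" "0 < G" "0 < e1" "e1 \<le> e0"
    "\<And>x. 0 < x \<Longrightarrow> x \<le> e1 \<Longrightarrow>
       \<bar>f x - (\<Sum>l\<in>{m..mp}. a l * x powi l)\<bar> \<le> G * x powr (real_of_int mp + \<delta>)"
    using h unfolding has_expansion_def by auto
  define S where "S = (\<Sum>l\<in>{m+1..mp}. \<bar>a l\<bar>)"
  have S: "0 \<le> S" unfolding S_def by (rule sum_nonneg) auto
  show ?thesis
  proof (rule leading_termI[of _ "G + S" e1])
    fix x assume x: "0 < x" "x \<le> e1"
    have x_le_1: "x \<le> 1" using x h(6) e0_le_1 by auto
    have "(\<Sum>l\<in>{m..mp}. a l * x powi l) = a m * x powr m + (\<Sum>l\<in>{m+1..mp}. a l * x powi l)"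
    proof -
      have "{m..mp} = insert m {m+1..mp}" using h(1) by auto
      then show ?thesis using x by (simp add: powi_eq_powr)
    qed
    then have "f x - a m * x powr m
        = (f x - (\<Sum>l\<in>{m..mp}. a l * x powi l)) + (\<Sum>l\<in>{m+1..mp}. a l * x powi l)"
      by simp
    also have "\<bar>\<dots>\<bar> \<le> G * x powr (real_of_int mp + \<delta>) + (\<Sum>l\<in>{m+1..mp}. \<bar>a l\<bar> * x powr (m + d))"
    proof (intro abs_triangle_ineq[THEN order_trans] add_mono h(7)[OF x]
        order_trans[OF sum_abs] sum_mono)
      fix l assume "l \<in> {m+1..mp}"
      then have "real_of_int m + d \<le> real_of_int l" using d_le_1 by auto
      then show "\<bar>a l * x powi l\<bar> \<le> \<bar>a l\<bar> * x powr (m + d)"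
        using x x_le_1 d_pos by (simp add: powi_eq_powr abs_mult mult_left_mono powr_mono')
    qed
    also have "\<dots> \<le> (G + S) * x powr (m + d)"
      using h(1,3,4) x x_le_1 \<open>d \<le> \<delta>\<close>
      by (simp add: S_def sum_distrib_right[symmetric] distrib_right powr_mono')
    finally show "\<bar>f x - a m * x powr m\<bar> \<le> (G + S) * x powr (m + d)" .
  qed (use h S in auto)
qed

lemma leading_term_imp_has_expansion:
  assumes "leading_term e0 d f m c"
  obtains G e1 where "has_expansion e0 f m m (\<lambda>_. c) d G e1"
proof -
  obtain G e1 where "0 < c" "0 < G" "0 < e1" "e1 \<le> e0"
    "\<And>x. 0 < x \<Longrightarrow> x \<le> e1 \<Longrightarrow> \<bar>f x - c * x powr m\<bar> \<le> G * x powr (m + d)"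
    using leading_termE[OF assms] by blast
  then have "has_expansion e0 f m m (\<lambda>_. c) d G e1"
    unfolding has_expansion_def using d_pos d_le_1 by (simp add: powi_eq_powr)
  then show ?thesis using that by blast
qed

end

definition asymptotic :: "real \<Rightarrow> real \<Rightarrow> (real \<Rightarrow> real) \<Rightarrow> bool" where
  "asymptotic e0 d f \<longleftrightarrow> (\<exists>m c. leading_term e0 d f m c)"

definition asymptotic_or_zero :: "real \<Rightarrow> real \<Rightarrow> (real \<Rightarrow> real) \<Rightarrow> bool" where
  "asymptotic_or_zero e0 d f \<longleftrightarrow> (\<forall>x. 0 < x \<and> x \<le> e0 \<longrightarrow> f x = 0) \<or> asymptotic e0 d f"

lemma asymptotic_cong:
  "asymptotic e0 d f \<Longrightarrow> (\<And>x. 0 < x \<Longrightarrow> x \<le> e0 \<Longrightarrow> f x = g x) \<Longrightarrow> asymptotic e0 d g"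
  unfolding asymptotic_def using leading_term_cong by blast

context asymptotic_scale
begin

lemma asymptotic_mult: "asymptotic e0 d f \<Longrightarrow> asymptotic e0 d g \<Longrightarrow> asymptotic e0 d (\<lambda>x. f x * g x)"
  unfolding asymptotic_def using leading_term_mult by blast

lemma asymptotic_divide: "asymptotic e0 d f \<Longrightarrow> asymptotic e0 d g \<Longrightarrow> asymptotic e0 d (\<lambda>x. f x / g x)"
  unfolding asymptotic_def using leading_term_divide by blast

lemma asymptotic_add_or_zero:
  assumes "asymptotic_or_zero e0 d f" "asymptotic_or_zero e0 d g" "asymptotic e0 d f \<or> asymptotic e0 d g"
  shows "asymptotic e0 d (\<lambda>x. f x + g x)"
proof -
  consider "asymptotic e0 d f" "asymptotic e0 d g"
    | "asymptotic e0 d f" "\<And>x. 0 < x \<Longrightarrow> x \<le> e0 \<Longrightarrow> g x = 0"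
    | "asymptotic e0 d g" "\<And>x. 0 < x \<Longrightarrow> x \<le> e0 \<Longrightarrow> f x = 0"
    using assms unfolding asymptotic_or_zero_def by blast
  then show ?thesis
  proof cases
    case 1
    then obtain m1 c1 m2 c2 where "leading_term e0 d f m1 c1" "leading_term e0 d g m2 c2"
      unfolding asymptotic_def by blast
    then obtain c where "leading_term e0 d (\<lambda>x. f x + g x) (min m1 m2) c"
      by (rule leading_term_add)
    then show ?thesis unfolding asymptotic_def by blast
  next
    case 2
    then show ?thesis by (elim asymptotic_cong) simp
  next
    case 3
    then show ?thesis by (elim asymptotic_cong) simp
  qed
qed

lemma asymptotic_or_zero_add:
  "asymptotic_or_zero e0 d f \<Longrightarrow> asymptotic_or_zero e0 d g \<Longrightarrow>
    asymptotic_or_zero e0 d (\<lambda>x. f x + g x)"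
  using asymptotic_add_or_zero unfolding asymptotic_or_zero_def by fastforce

lemma asymptotic_or_zero_mult:
  "asymptotic_or_zero e0 d f \<Longrightarrow> asymptotic_or_zero e0 d g \<Longrightarrow>
    asymptotic_or_zero e0 d (\<lambda>x. f x * g x)"
  using asymptotic_mult unfolding asymptotic_or_zero_def by auto

lemma asymptotic_or_zero_divide:
  "asymptotic_or_zero e0 d f \<Longrightarrow> asymptotic e0 d g \<Longrightarrow>
    asymptotic_or_zero e0 d (\<lambda>x. f x / g x)"
  using asymptotic_divide unfolding asymptotic_or_zero_def by auto

end

definition step_rel :: "('a \<Rightarrow> 'a set) \<Rightarrow> ('a \<times> 'a) set" where
  "step_rel Y = {(u, v). v \<in> Y u}"

lemma chain_iff_trancl_step_rel:
  "(\<exists>n::nat. n \<ge> 1 \<and> (\<exists>l. l 0 = i \<and> l n = j \<and> (\<forall>m\<in>{1..n}. l m \<in> Y (l (m - 1)))))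
     \<longleftrightarrow> (i, j) \<in> (step_rel Y)\<^sup>+"
proof -
  have "(\<forall>m\<in>{1..n}. l m \<in> Y (l (m - 1))) \<longleftrightarrow> (\<forall>k<n. (l k, l (Suc k)) \<in> step_rel Y)"
    for n and l :: "nat \<Rightarrow> 'a"
    unfolding step_rel_def image_Suc_lessThan[symmetric] by auto
  then show ?thesis by (simp add: trancl_power relpow_fun_conv Suc_le_eq)
qed

lemma trancl_step_rel_leaves:
  assumes "(r, j) \<in> (step_rel Y)\<^sup>+" "j \<noteq> r"
  shows "Y r - {r} \<noteq> {}"
proof -
  have "y \<noteq> r \<longrightarrow> Y r - {r} \<noteq> {}" if "(r, y) \<in> (step_rel Y)\<^sup>+" for y
    using that by (induction rule: trancl_induct) (auto simp: step_rel_def)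
  then show ?thesis using assms by blast
qed

text \<open>A path of the original chain starting outside \<open>r\<close> is a path of the reduced chain
  after deleting its visits to \<open>r\<close>; a visit to \<open>r\<close> is bridged by any successor \<open>w \<noteq> r\<close>.\<close>
lemma trancl_step_rel_red_Y:
  assumes Y: "\<And>u. u \<in> S \<Longrightarrow> Y u \<subseteq> S" and r: "r \<in> S" and x: "x \<in> S - {r}"
    and xy: "(x, y) \<in> (step_rel Y)\<^sup>+"
  shows "(y \<noteq> r \<longrightarrow> (x, y) \<in> (step_rel (red_Y S Y r))\<^sup>+) \<and>
         (y = r \<longrightarrow> (\<forall>w\<in>Y r - {r}. (x, w) \<in> (step_rel (red_Y S Y r))\<^sup>+))"
  using xy
proof (induction rule: trancl_induct)
  case (base y)
  then show ?case using Y r x by (auto simp: step_rel_def red_Y_def)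
next
  case (step y z)
  have "y \<in> S" using step.hyps(1) Y x by (induction rule: trancl_induct) (auto simp: step_rel_def)
  then show ?case using step Y r
    by (auto simp: step_rel_def red_Y_def intro: trancl_into_trancl)
qed

locale smp_reduction =
  fixes S :: "nat set" and e0 :: real and p e :: kern and Y :: "nat \<Rightarrow> nat set" and r :: nat
  assumes finite_S: "finite S" and r_in_S: "r \<in> S" and other_state: "S - {r} \<noteq> {}"
    and regular: "smp_regular S e0 p e" and condA: "condA S e0 p Y"
begin

lemma Y_subset: "i \<in> S \<Longrightarrow> Y i \<subseteq> S"
  using condA unfolding condA_def by blast

lemma Y_nonempty: "i \<in> S \<Longrightarrow> Y i \<noteq> {}"
  using condA unfolding condA_def by blast

lemma p_pos: "0 < x \<Longrightarrow> x \<le> e0 \<Longrightarrow> i \<in> S \<Longrightarrow> j \<in> Y i \<Longrightarrow> 0 < p x i j"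
  using condA Y_subset unfolding condA_def by blast

lemma p_zero: "0 < x \<Longrightarrow> x \<le> e0 \<Longrightarrow> i \<in> S \<Longrightarrow> j \<in> S \<Longrightarrow> j \<notin> Y i \<Longrightarrow> p x i j = 0"
  using condA unfolding condA_def by blast

lemma p_nonneg: "0 < x \<Longrightarrow> x \<le> e0 \<Longrightarrow> i \<in> S \<Longrightarrow> j \<in> S \<Longrightarrow> 0 \<le> p x i j"
  and e_nonneg: "0 < x \<Longrightarrow> x \<le> e0 \<Longrightarrow> i \<in> S \<Longrightarrow> j \<in> S \<Longrightarrow> 0 \<le> e x i j"
  and e_zero_if_p_zero: "0 < x \<Longrightarrow> x \<le> e0 \<Longrightarrow> i \<in> S \<Longrightarrow> j \<in> S \<Longrightarrow> p x i j = 0 \<Longrightarrow> e x i j = 0"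
  and p_row_sum: "0 < x \<Longrightarrow> x \<le> e0 \<Longrightarrow> i \<in> S \<Longrightarrow> (\<Sum>j\<in>S. p x i j) = 1"
  using regular unfolding smp_regular_def by blast+

lemma e_zero: "0 < x \<Longrightarrow> x \<le> e0 \<Longrightarrow> i \<in> S \<Longrightarrow> j \<in> S \<Longrightarrow> j \<notin> Y i \<Longrightarrow> e x i j = 0"
  using p_zero e_zero_if_p_zero by blast

lemma reachable: "i \<in> S \<Longrightarrow> j \<in> S \<Longrightarrow> (i, j) \<in> (step_rel Y)\<^sup>+"
  using condA unfolding condA_def chain_iff_trancl_step_rel by blast

lemma escape_set_nonempty: "Y r - {r} \<noteq> {}"
proof -
  obtain j where j: "j \<in> S" "j \<noteq> r" using other_state by blast
  show ?thesis by (rule trancl_step_rel_leaves[OF reachable[OF r_in_S j(1)] j(2)])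
qed

lemma escape_set_subset: "Y r - {r} \<subseteq> S - {r}"
  using Y_subset r_in_S by blast

lemma escape_prob_eq:
  assumes "0 < x" "x \<le> e0"
  shows "1 - p x r r = (\<Sum>j\<in>Y r - {r}. p x r j)"
proof -
  have "1 = p x r r + (\<Sum>j\<in>S - {r}. p x r j)"
    using p_row_sum[OF assms r_in_S] finite_S r_in_S by (simp add: sum.remove)
  also have "(\<Sum>j\<in>S - {r}. p x r j) = (\<Sum>j\<in>Y r - {r}. p x r j)"
    using finite_S escape_set_subset p_zero[OF assms r_in_S] by (intro sum.mono_neutral_right) auto
  finally show ?thesis by simp
qed

lemma escape_prob_pos:
  assumes "0 < x" "x \<le> e0"
  shows "0 < 1 - p x r r"
proof -
  have "finite (Y r - {r})" using finite_S escape_set_subset finite_subset by blast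
  then have "0 < (\<Sum>j\<in>Y r - {r}. p x r j)"
    using escape_set_nonempty p_pos[OF assms r_in_S] by (intro sum_pos) auto
  then show ?thesis using escape_prob_eq[OF assms] by simp
qed

lemma red_p_pos:
  assumes "0 < x" "x \<le> e0" "i \<in> S - {r}" "j \<in> red_Y S Y r i"
  shows "0 < red_p p r x i j"
proof -
  have "0 < p x i j \<or> (0 < p x i r \<and> 0 < p x r j)"
    using assms p_pos r_in_S unfolding red_Y_def by auto
  moreover have "0 \<le> p x i j" "0 \<le> p x i r" "0 \<le> p x r j"
    using assms p_nonneg r_in_S unfolding red_Y_def by auto
  moreover have "0 < 1 - p x r r" using escape_prob_pos assms by blast
  ultimately show ?thesis
    unfolding red_p_def by (auto intro: add_pos_nonneg add_nonneg_pos)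
qed

lemma red_p_zero:
  assumes "0 < x" "x \<le> e0" "i \<in> S - {r}" "j \<in> S - {r}" "j \<notin> red_Y S Y r i"
  shows "red_p p r x i j = 0"
proof -
  have "j \<notin> Y i" "r \<notin> Y i \<or> j \<notin> Y r" using assms unfolding red_Y_def by auto
  then have "p x i j = 0" "p x i r = 0 \<or> p x r j = 0"
    using assms p_zero r_in_S by auto
  then show ?thesis unfolding red_p_def by auto
qed

lemma condA_red: "condA (S - {r}) e0 (red_p p r) (red_Y S Y r)"
proof -
  have "red_Y S Y r i \<noteq> {}" if i: "i \<in> S - {r}" for i
  proof -
    obtain y where "y \<in> Y i" using Y_nonempty i by blast
    moreover obtain w where "w \<in> Y r - {r}" using escape_set_nonempty by blast
    ultimately show ?thesis
      using i Y_subset escape_set_subset unfolding red_Y_def by (cases "y = r") blast+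
  qed
  moreover have "(i, j) \<in> (step_rel (red_Y S Y r))\<^sup>+" if "i \<in> S - {r}" "j \<in> S - {r}" for i j
    using trancl_step_rel_red_Y[OF Y_subset r_in_S that(1) reachable] that by blast
  ultimately show ?thesis
    unfolding condA_def chain_iff_trancl_step_rel
    using red_p_pos red_p_zero by (auto simp: red_Y_def)
qed

lemma red_p_nonneg:
  assumes "0 < x" "x \<le> e0" "i \<in> S - {r}" "j \<in> S - {r}"
  shows "0 \<le> red_p p r x i j"
proof -
  have "0 < 1 - p x r r" using escape_prob_pos assms by blast
  moreover have "0 \<le> p x i j" "0 \<le> p x i r" "0 \<le> p x r j"
    using assms p_nonneg r_in_S by auto
  ultimately show ?thesis unfolding red_p_def by simp
qed

lemma red_e_nonneg:
  assumes "0 < x" "x \<le> e0" "i \<in> S - {r}" "j \<in> S - {r}"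
  shows "0 \<le> red_e p e r x i j"
proof -
  have "0 < 1 - p x r r" using escape_prob_pos assms by blast
  moreover have "0 \<le> p x i r" "0 \<le> p x r j" "0 \<le> e x i j" "0 \<le> e x i r" "0 \<le> e x r r" "0 \<le> e x r j"
    using assms p_nonneg e_nonneg r_in_S by auto
  ultimately show ?thesis unfolding red_e_def by simp
qed

lemma red_e_zero_if_red_p_zero:
  assumes x: "0 < x" "x \<le> e0" and ij: "i \<in> S - {r}" "j \<in> S - {r}"
    and zero: "red_p p r x i j = 0"
  shows "red_e p e r x i j = 0"
proof -
  have q: "0 < 1 - p x r r" using escape_prob_pos x by blast
  have "0 \<le> p x i j" "0 \<le> p x i r * (p x r j / (1 - p x r r))"
    using x ij q p_nonneg r_in_S by simp_all
  then have "p x i j = 0" "p x i r * (p x r j / (1 - p x r r)) = 0"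
    using zero unfolding red_p_def by linarith+
  then have "p x i j = 0" "p x i r = 0 \<or> p x r j = 0" using q by auto
  then show ?thesis
    unfolding red_e_def using x ij r_in_S e_zero_if_p_zero by auto
qed

lemma red_p_row_sum:
  assumes x: "0 < x" "x \<le> e0" and i: "i \<in> S - {r}"
  shows "(\<Sum>j\<in>S - {r}. red_p p r x i j) = 1"
proof -
  have "(\<Sum>j\<in>S - {r}. red_p p r x i j)
      = (\<Sum>j\<in>S - {r}. p x i j) + p x i r / (1 - p x r r) * (\<Sum>j\<in>S - {r}. p x r j)"
    unfolding red_p_def by (simp add: sum.distrib sum_distrib_left)
  also have "\<dots> = (1 - p x i r) + p x i r / (1 - p x r r) * (1 - p x r r)"
  proof -
    have "(\<Sum>j\<in>S - {r}. p x k j) = 1 - p x k r" if "k \<in> S" for k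
      using p_row_sum[OF x that] sum.remove[OF finite_S r_in_S, of "p x k"] by simp
    then show ?thesis using i r_in_S by simp
  qed
  also have "\<dots> = 1" using escape_prob_pos[OF x] by simp
  finally show ?thesis .
qed

lemma smp_regular_red: "smp_regular (S - {r}) e0 (red_p p r) (red_e p e r)"
  unfolding smp_regular_def
  using red_p_nonneg red_e_nonneg red_e_zero_if_red_p_zero red_p_row_sum by blast

end

locale asymptotic_smp_reduction = smp_reduction S e0 p e Y r + asymptotic_scale e0 d
  for S e0 p e Y r d
begin

lemma leading_term_escape_prob:
  assumes "\<forall>j\<in>Y r. leading_term e0 d (\<lambda>x. p x r j) (m j) (c j)"
  obtains M C where "leading_term e0 d (\<lambda>x. 1 - p x r r) M C" "\<forall>j\<in>Y r - {r}. M \<le> m j"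
proof -
  have "finite (Y r - {r})" using finite_S escape_set_subset finite_subset by blast
  then obtain M C where "leading_term e0 d (\<lambda>x. \<Sum>j\<in>Y r - {r}. p x r j) M C" "\<forall>j\<in>Y r - {r}. M \<le> m j"
    using leading_term_sum[OF _ escape_set_nonempty, of "\<lambda>j x. p x r j" m c] assms by blast
  moreover have "leading_term e0 d (\<lambda>x. 1 - p x r r) M C"
    using calculation(1) by (rule leading_term_cong) (simp add: escape_prob_eq)
  ultimately show ?thesis using that by blast
qed

lemma red_p_leading_term:
  assumes P: "\<forall>i\<in>S. \<forall>j\<in>Y i. leading_term e0 d (\<lambda>x. p x i j) (m i j) (c i j) \<and> 0 \<le> m i j"
    and i: "i \<in> S - {r}" and j: "j \<in> red_Y S Y r i"
  obtains m' c' where "leading_term e0 d (\<lambda>x. red_p p r x i j) m' c'" "0 \<le> m'"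
proof -
  obtain M C where Q: "leading_term e0 d (\<lambda>x. 1 - p x r r) M C" and M: "\<forall>j\<in>Y r - {r}. M \<le> m r j"
    using leading_term_escape_prob[of "m r" "c r"] P r_in_S by blast
  have j': "j \<in> S - {r}" using j unfolding red_Y_def by blast
  show ?thesis
  proof (cases "r \<in> Y i \<and> j \<in> Y r")
    case via_r: True
    let ?T = "\<lambda>x. p x i r * (p x r j / (1 - p x r r))"
    have T: "leading_term e0 d ?T (m i r + (m r j - M)) (c i r * (c r j / C))"
      using P i via_r r_in_S by (intro leading_term_mult leading_term_divide Q) auto
    have "0 \<le> m i r" "M \<le> m r j" using P M i j' via_r by auto
    then have T_order: "0 \<le> m i r + (m r j - M)" by linarith
    show ?thesis
    proof (cases "j \<in> Y i")
      case True
      then obtain c' where "leading_term e0 d (\<lambda>x. red_p p r x i j) (min (m i j) (m i r + (m r j - M))) c'"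
        using P i leading_term_add[OF _ T, of "\<lambda>x. p x i j"] unfolding red_p_def by blast
      then show ?thesis using that T_order P i True by fastforce
    next
      case False
      have "leading_term e0 d (\<lambda>x. red_p p r x i j) (m i r + (m r j - M)) (c i r * (c r j / C))"
        using T by (rule leading_term_cong) (use p_zero i j' False in \<open>auto simp: red_p_def\<close>)
      then show ?thesis using that T_order by blast
    qed
  next
    case False
    then have "j \<in> Y i" using j unfolding red_Y_def by blast
    have "leading_term e0 d (\<lambda>x. red_p p r x i j) (m i j) (c i j)"
    proof (rule leading_term_cong)
      show "leading_term e0 d (\<lambda>x. p x i j) (m i j) (c i j)" using P i \<open>j \<in> Y i\<close> by blast
      fix x assume "0 < x" "x \<le> e0"
      then have "p x i r = 0 \<or> p x r j = 0" using False p_zero i j' r_in_S by blast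
      then show "p x i j = red_p p r x i j" unfolding red_p_def by auto
    qed
    then show ?thesis using that P i \<open>j \<in> Y i\<close> by blast
  qed
qed

lemma condD'_red:
  assumes "\<forall>i\<in>S. \<forall>j\<in>Y i. leading_term e0 d (\<lambda>x. p x i j) (m i j) (c i j) \<and> 0 \<le> m i j"
  shows "condD' (S - {r}) e0 (red_p p r) (red_Y S Y r)"
  unfolding condD'_def
proof (intro ballI)
  fix i j assume "i \<in> S - {r}" "j \<in> red_Y S Y r i"
  then obtain m' c' where "leading_term e0 d (\<lambda>x. red_p p r x i j) m' c'" "0 \<le> m'"
    using red_p_leading_term assms by blast
  then show "\<exists>lm lp a \<delta> G e1. 0 \<le> lm \<and> has_expansion e0 (\<lambda>x. red_p p r x i j) lm lp a \<delta> G e1"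
    using leading_term_imp_has_expansion by meson
qed

lemma red_e_asymptotic:
  assumes P: "\<forall>i\<in>S. \<forall>j\<in>Y i. leading_term e0 d (\<lambda>x. p x i j) (m i j) (c i j)"
    and E: "\<forall>i\<in>S. \<forall>j\<in>Y i. asymptotic e0 d (\<lambda>x. e x i j)"
    and i: "i \<in> S - {r}" and j: "j \<in> red_Y S Y r i"
  shows "asymptotic e0 d (\<lambda>x. red_e p e r x i j)"
proof -
  have "\<forall>j\<in>Y r. leading_term e0 d (\<lambda>x. p x r j) (m r j) (c r j)" using P r_in_S by blast
  then obtain M C where "leading_term e0 d (\<lambda>x. 1 - p x r r) M C"
    by (rule leading_term_escape_prob)
  then have Q: "asymptotic e0 d (\<lambda>x. 1 - p x r r)" unfolding asymptotic_def by blast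
  have P': "asymptotic e0 d (\<lambda>x. p x k l)" if "k \<in> S" "l \<in> Y k" for k l
    using P that unfolding asymptotic_def by blast
  have P0: "asymptotic_or_zero e0 d (\<lambda>x. p x k l)" if k: "k \<in> S" "l \<in> S" for k l
    using P'[OF k(1)] p_zero[OF _ _ k] unfolding asymptotic_or_zero_def by (cases "l \<in> Y k") auto
  have E0: "asymptotic_or_zero e0 d (\<lambda>x. e x k l)" if k: "k \<in> S" "l \<in> S" for k l
    using E k(1) e_zero[OF _ _ k] unfolding asymptotic_or_zero_def by (cases "l \<in> Y k") auto
  have ij: "i \<in> S" "j \<in> S" using i j unfolding red_Y_def by auto
  let ?T1 = "\<lambda>x. e x i j"
  let ?T2 = "\<lambda>x. e x i r * (p x r j / (1 - p x r r))"
  let ?T3 = "\<lambda>x. e x r r * (p x i r / (1 - p x r r)) * (p x r j / (1 - p x r r))"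
  let ?T4 = "\<lambda>x. e x r j * (p x i r / (1 - p x r r))"
  have p_ir: "asymptotic_or_zero e0 d (\<lambda>x. p x i r / (1 - p x r r))"
    and p_rj: "asymptotic_or_zero e0 d (\<lambda>x. p x r j / (1 - p x r r))"
    using asymptotic_or_zero_divide[OF P0 Q] ij r_in_S by auto
  have T: "asymptotic_or_zero e0 d ?T1" "asymptotic_or_zero e0 d ?T2"
    "asymptotic_or_zero e0 d ?T3" "asymptotic_or_zero e0 d ?T4"
    using ij r_in_S E0 asymptotic_or_zero_mult[OF _ p_ir] asymptotic_or_zero_mult[OF _ p_rj]
    by blast+
  have "asymptotic e0 d ?T1 \<or> asymptotic e0 d ?T4"
  proof (cases "j \<in> Y i")
    case True
    then have "asymptotic e0 d ?T1" using E ij by blast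
    then show ?thesis ..
  next
    case False
    then have "r \<in> Y i" "j \<in> Y r" using j unfolding red_Y_def by auto
    then have "asymptotic e0 d ?T4"
      using asymptotic_mult[OF E[rule_format] asymptotic_divide[OF P' Q]] ij r_in_S by blast
    then show ?thesis ..
  qed
  then have T14: "asymptotic e0 d (\<lambda>x. ?T1 x + ?T4 x)"
    by (rule asymptotic_add_or_zero[OF T(1) T(4)])
  then have "asymptotic_or_zero e0 d (\<lambda>x. ?T1 x + ?T4 x)"
    unfolding asymptotic_or_zero_def by blast
  from asymptotic_add_or_zero[OF this asymptotic_or_zero_add[OF T(2) T(3)]] T14
  have "asymptotic e0 d (\<lambda>x. (?T1 x + ?T4 x) + (?T2 x + ?T3 x))" by blast
  then show ?thesis by (rule asymptotic_cong) (simp add: red_e_def ac_simps)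
qed

end

lemma Min_transition_bounds:
  fixes f :: "'a \<Rightarrow> 'a \<Rightarrow> real"
  assumes "finite S" "\<And>i. i \<in> S \<Longrightarrow> finite (Y i)" "i0 \<in> S" "j0 \<in> Y i0"
    and bounds: "\<And>i j. i \<in> S \<Longrightarrow> j \<in> Y i \<Longrightarrow> 0 < f i j \<and> f i j \<le> 1"
  defines "D \<equiv> Min {f i j | i j. i \<in> S \<and> j \<in> Y i}"
  shows "0 < D \<and> D \<le> 1 \<and> (\<forall>i\<in>S. \<forall>j\<in>Y i. D \<le> f i j)"
proof -
  have eq: "{f i j | i j. i \<in> S \<and> j \<in> Y i} = (\<lambda>(i, j). f i j) ` (SIGMA i:S. Y i)" by auto
  have fin: "finite {f i j | i j. i \<in> S \<and> j \<in> Y i}" unfolding eq using assms by auto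
  have le: "D \<le> f i j" if "i \<in> S" "j \<in> Y i" for i j
    unfolding D_def using fin that by (intro Min_le) auto
  have "D \<in> {f i j | i j. i \<in> S \<and> j \<in> Y i}"
    unfolding D_def using fin assms(3,4) by (intro Min_in) auto
  then show ?thesis using bounds le assms(3,4) by fastforce
qed

lemma reduced_process_conditions:
  fixes S :: "nat set" and r :: nat and lm mm :: "nat \<Rightarrow> nat \<Rightarrow> int"
    and a b :: "nat \<Rightarrow> nat \<Rightarrow> int \<Rightarrow> real"
  assumes "finite S" "r \<in> S" "S - {r} \<noteq> {}" and "e0 \<le> 1"
    and reg: "smp_regular S e0 p e" and A: "condA S e0 p Y"
    and D': "\<forall>i\<in>S. \<forall>j\<in>Y i. 0 \<le> lm i j \<and>
               has_expansion e0 (\<lambda>x. p x i j) (lm i j) (lp i j) (a i j) (delta i j) (G i j) (eps1 i j)"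
    and E': "\<forall>i\<in>S. \<forall>j\<in>Y i.
               has_expansion e0 (\<lambda>x. e x i j) (mm i j) (mp i j) (b i j) (ddelta i j) (dG i j) (deps1 i j)"
  shows "condA (S - {r}) e0 (red_p p r) (red_Y S Y r)
    \<and> smp_regular (S - {r}) e0 (red_p p r) (red_e p e r)
    \<and> condD' (S - {r}) e0 (red_p p r) (red_Y S Y r)
    \<and> (\<forall>i\<in>S - {r}. \<forall>j\<in>red_Y S Y r i. \<exists>rmm rmp rb rdd rdG rde.
         has_expansion e0 (\<lambda>x. red_e p e r x i j) rmm rmp rb rdd rdG rde
         \<and> rdd \<ge> Min {min (delta i' j') (ddelta i' j') | i' j'. i' \<in> S \<and> j' \<in> Y i'})"
proof -
  interpret smp_reduction S e0 p e Y r using assms by unfold_locales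
  define d where "d = Min {min (delta i j) (ddelta i j) | i j. i \<in> S \<and> j \<in> Y i}"
  obtain j0 where j0: "j0 \<in> Y r" using Y_nonempty r_in_S by blast
  have fin: "\<And>i. i \<in> S \<Longrightarrow> finite (Y i)" using Y_subset finite_S finite_subset by blast
  have bounds: "0 < min (delta i j) (ddelta i j) \<and> min (delta i j) (ddelta i j) \<le> 1"
    if "i \<in> S" "j \<in> Y i" for i j
  proof -
    have "0 < delta i j" "delta i j \<le> 1" "0 < ddelta i j" "ddelta i j \<le> 1"
      using D' E' that unfolding has_expansion_def by auto
    then show ?thesis by simp
  qed
  have d: "0 < d \<and> d \<le> 1 \<and> (\<forall>i\<in>S. \<forall>j\<in>Y i. d \<le> min (delta i j) (ddelta i j))"
    unfolding d_def using finite_S fin r_in_S j0 bounds by (rule Min_transition_bounds)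
  interpret asymptotic_smp_reduction S e0 p e Y r d
    using d \<open>e0 \<le> 1\<close> by unfold_locales auto
  have P: "\<forall>i\<in>S. \<forall>j\<in>Y i. leading_term e0 d (\<lambda>x. p x i j) (lm i j) (a i j (lm i j)) \<and> 0 \<le> lm i j"
  proof (intro ballI conjI)
    fix i j assume ij: "i \<in> S" "j \<in> Y i"
    show "leading_term e0 d (\<lambda>x. p x i j) (lm i j) (a i j (lm i j))"
      using D' d ij by (intro has_expansion_imp_leading_term) auto
    show "0 \<le> lm i j" using D' ij by blast
  qed
  have E: "\<forall>i\<in>S. \<forall>j\<in>Y i. asymptotic e0 d (\<lambda>x. e x i j)"
  proof (intro ballI)
    fix i j assume ij: "i \<in> S" "j \<in> Y i"
    have "leading_term e0 d (\<lambda>x. e x i j) (mm i j) (b i j (mm i j))"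
      using E' d ij by (intro has_expansion_imp_leading_term) auto
    then show "asymptotic e0 d (\<lambda>x. e x i j)" unfolding asymptotic_def by blast
  qed
  show ?thesis
  proof (intro conjI ballI condA_red smp_regular_red condD'_red[OF P])
    fix i j assume ij: "i \<in> S - {r}" "j \<in> red_Y S Y r i"
    have "\<forall>i\<in>S. \<forall>j\<in>Y i. leading_term e0 d (\<lambda>x. p x i j) (lm i j) (a i j (lm i j))"
      using P by blast
    from red_e_asymptotic[OF this E ij] obtain m c where "leading_term e0 d (\<lambda>x. red_e p e r x i j) m c"
      unfolding asymptotic_def by blast
    then obtain rdG rde where "has_expansion e0 (\<lambda>x. red_e p e r x i j) m m (\<lambda>_. c) d rdG rde"
      by (rule leading_term_imp_has_expansion)
    then show "\<exists>rmm rmp rb rdd rdG rde.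
         has_expansion e0 (\<lambda>x. red_e p e r x i j) rmm rmp rb rdd rdG rde
         \<and> rdd \<ge> Min {min (delta i' j') (ddelta i' j') | i' j'. i' \<in> S \<and> j' \<in> Y i'}"
      unfolding d_def[symmetric] by blast
  qed
qed

theorem theorem2:
  fixes N :: nat and eps0 :: real and p e :: kern and Y :: "nat \<Rightarrow> nat set"
    and lm lp :: "nat \<Rightarrow> nat \<Rightarrow> int" and a :: "nat \<Rightarrow> nat \<Rightarrow> int \<Rightarrow> real"
    and delta G eps1 :: "nat \<Rightarrow> nat \<Rightarrow> real"
    and mm mp :: "nat \<Rightarrow> nat \<Rightarrow> int" and b :: "nat \<Rightarrow> nat \<Rightarrow> int \<Rightarrow> real"
    and ddelta dG deps1 :: "nat \<Rightarrow> nat \<Rightarrow> real"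
  assumes N2: "N \<ge> 2"
    and eps0: "0 < eps0" "eps0 \<le> 1"
    and reg: "smp_regular {1..N} eps0 p e"
    and A: "condA {1..N} eps0 p Y"
    and D': "\<forall>i\<in>{1..N}. \<forall>j\<in>Y i. 0 \<le> lm i j \<and>
               has_expansion eps0 (\<lambda>eps. p eps i j) (lm i j) (lp i j) (a i j)
                 (delta i j) (G i j) (eps1 i j)"
    and E': "\<forall>i\<in>{1..N}. \<forall>j\<in>Y i.
               has_expansion eps0 (\<lambda>eps. e eps i j) (mm i j) (mp i j) (b i j)
                 (ddelta i j) (dG i j) (deps1 i j)"
  shows "\<forall>r\<in>{1..N}.
           condA ({1..N} - {r}) eps0 (red_p p r) (red_Y {1..N} Y r)
         \<and> smp_regular ({1..N} - {r}) eps0 (red_p p r) (red_e p e r)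
         \<and> condD' ({1..N} - {r}) eps0 (red_p p r) (red_Y {1..N} Y r)
         \<and> (\<forall>i\<in>{1..N} - {r}. \<forall>j\<in>red_Y {1..N} Y r i.
              \<exists>rmm rmp rb rdd rdG rde.
                has_expansion eps0 (\<lambda>eps. red_e p e r eps i j) rmm rmp rb rdd rdG rde
              \<and> rdd \<ge> Min {min (delta i' j') (ddelta i' j') | i' j'. i' \<in> {1..N} \<and> j' \<in> Y i'})"
proof (rule ballI, rule reduced_process_conditions[OF _ _ _ eps0(2) reg A D' E'])
  fix r assume r: "r \<in> {1..N}"
  have "(if r = 1 then 2 else 1) \<in> {1..N} - {r}" using N2 r by auto
  then show "{1..N} - {r} \<noteq> {}" by blast
qed auto

end
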